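(* For the double star $DS_{2,2}$, we have the following inequality: $$\frac{5n}{2} \leq \operatorname{ex}^\star(n, DS_{2,2}) \leq \frac{6n}{2}.$$
   Context: All colorings are edge colorings. $DS_{2,2}$ is the tree formed by taking a single edge $yx$ and appending $2$ leaves to $y$ and $2$ leaves to $x$. A subgraph of an edge-colored graph is rainbow if all its edges have distinct colors. For a graph $F$, the rainbow Turán number $\operatorname{ex}^\star(n,F)$ is the largest number of edges among those $n$-vertex graphs that can be properly edge-colored in a way that contains no rainbow $F$ subgraph. Here $n$ denotes the number of vertices.
   Formalization: The lower bound 5n/2 is false for some n (for n = 1 there are no edges), so it is stated exactly when 6 divides n, and as 5n/2 − C with an absolute constant C for all n; the upper bound 6n/2 is stated for every n. *)

theory Defs
  imports Complex_Main "HOL-Library.Ramsey"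
begin

text \<open>A finite simple graph is given by a vertex set \<open>V\<close> and an edge set \<open>E \<subseteq> nsets V 2\<close>,
  i.e. edges are two-element subsets of \<open>V\<close>.\<close>

definition simple_graph :: "'a set \<Rightarrow> 'a set set \<Rightarrow> bool" where
  "simple_graph V E \<longleftrightarrow> finite V \<and> E \<subseteq> nsets V 2"

definition graph_iso :: "'a set \<Rightarrow> 'a set set \<Rightarrow> 'b set \<Rightarrow> 'b set set \<Rightarrow> bool" where
  "graph_iso V E V' E' \<longleftrightarrow> (\<exists>\<phi>. bij_betw \<phi> V V' \<and> E' = (\<lambda>e. \<phi> ` e) ` E)"

definition proper_edge_coloring :: "'a set set \<Rightarrow> ('a set \<Rightarrow> 'c) \<Rightarrow> bool" where
  "proper_edge_coloring E c \<longleftrightarrow>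
     (\<forall>e\<in>E. \<forall>f\<in>E. e \<noteq> f \<and> e \<inter> f \<noteq> {} \<longrightarrow> c e \<noteq> c f)"

definition rainbow :: "'a set set \<Rightarrow> ('a set \<Rightarrow> 'c) \<Rightarrow> bool" where
  "rainbow E c \<longleftrightarrow> inj_on c E"

text \<open>Subgraphs are not required to be induced.\<close>

definition contains_rainbow ::
    "'a set \<Rightarrow> 'a set set \<Rightarrow> ('a set \<Rightarrow> 'c) \<Rightarrow> 'b set \<Rightarrow> 'b set set \<Rightarrow> bool" where
  "contains_rainbow V E c VF EF \<longleftrightarrow>
     (\<exists>V' E'. V' \<subseteq> V \<and> E' \<subseteq> E \<and> simple_graph V' E' \<and> graph_iso VF EF V' E' \<and> rainbow E' c)"

text \<open>Up to isomorphism an \<open>n\<close>-vertex graph has vertex set \<open>{..<n}\<close>; since graphs are finite,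
  natural numbers suffice as colors, and the number of colors is not restricted.\<close>

definition rainbow_turan_candidates :: "nat \<Rightarrow> 'b set \<Rightarrow> 'b set set \<Rightarrow> nat set set set" where
  "rainbow_turan_candidates n VF EF =
     {E. simple_graph {..<n} E \<and>
         (\<exists>c :: nat set \<Rightarrow> nat.
            proper_edge_coloring E c \<and> \<not> contains_rainbow {..<n} E c VF EF)}"

definition rainbow_turan :: "nat \<Rightarrow> 'b set \<Rightarrow> 'b set set \<Rightarrow> nat" where
  "rainbow_turan n VF EF = Max (card ` rainbow_turan_candidates n VF EF)"

text \<open>The maximum is well defined as soon as the forbidden graph has an edge.\<close>

lemma finite_rainbow_turan_candidates: "finite (rainbow_turan_candidates n VF EF)"
  by (rule finite_subset[of _ "Pow (Pow {..<n})"])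
     (auto simp: rainbow_turan_candidates_def simple_graph_def nsets_def)

lemma rainbow_turan_candidates_nonempty:
  assumes "EF \<noteq> {}"
  shows "rainbow_turan_candidates n VF EF \<noteq> {}"
proof -
  have "{} \<in> rainbow_turan_candidates n VF EF"
    using assms
    by (auto simp: rainbow_turan_candidates_def simple_graph_def proper_edge_coloring_def
        contains_rainbow_def graph_iso_def)
  then show ?thesis by blast
qed

text \<open>The double star \<open>DS\<^sub>2\<^sub>,\<^sub>2\<close>: the central edge is \<open>{0, 1}\<close>, the leaves at \<open>0\<close> are \<open>2, 3\<close>
  and the leaves at \<open>1\<close> are \<open>4, 5\<close>.\<close>

definition DS22_verts :: "nat set" where
  "DS22_verts = {0, 1, 2, 3, 4, 5}"

definition DS22_edges :: "nat set set" where
  "DS22_edges = {{0, 1}, {0, 2}, {0, 3}, {1, 4}, {1, 5}}"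

end

theory Submission imports Defs begin

text \<open>
  \<^emph>\<open>Upper bound.\<close>  If \<open>v\<close> has at least seven neighbours and some neighbour \<open>u\<close> of \<open>v\<close> has at
  least three, then \<open>uv\<close> is the centre of a rainbow double star: choose any two further
  neighbours \<open>p, q\<close> of \<open>u\<close>; of the six further neighbours of \<open>v\<close> at most two are lost to \<open>p\<close>
  and \<open>q\<close> themselves and at most two to the colors of \<open>up\<close> and \<open>uq\<close>, so that two remain as
  leaves at \<open>v\<close> (\<open>rainbow_double_star_exists\<close>).  Hence a graph without a rainbow double star
  either has a vertex of degree at most three, which can be deleted, or has all degrees at most
  six; induction on the number of vertices gives at most \<open>3n\<close> edges
  (\<open>card_edges_le_3_card_verts\<close>).

  \<^emph>\<open>Lower bound.\<close>  Take disjoint copies of \<open>K\<^sub>6\<close>, each with the coloring in five colors whose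
  color classes are perfect matchings, any two of which form a Hamiltonian cycle.  A double
  star in \<open>K\<^sub>6\<close> is spanning.  Suppose that it is rainbow, with centre \<open>yx\<close> and leaves \<open>p, q\<close> at
  \<open>y\<close> and \<open>r, s\<close> at \<open>x\<close>.  All five colors occur at \<open>x\<close>, and those of \<open>xy\<close>, \<open>xr\<close>, \<open>xs\<close> are not
  used on \<open>yp\<close>, \<open>yq\<close>; so the colors of \<open>yp\<close> and \<open>yq\<close> are those of \<open>xp\<close> and \<open>xq\<close>, necessarily
  interchanged.  Then \<open>ypxq\<close> is a 4-cycle in two colors, which does not exist.  Each copy
  contributes 15 edges on six vertices, and at most five vertices are left over.
\<close>

section \<open>Rainbow double stars in terms of six vertices\<close>

lemma contains_rainbow_DS22E:
  assumes "contains_rainbow V E c DS22_verts DS22_edges"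
  obtains y x p q r s where "distinct [y, x, p, q, r, s]"
    "{{y, x}, {y, p}, {y, q}, {x, r}, {x, s}} \<subseteq> E"
    "distinct [c {y, x}, c {y, p}, c {y, q}, c {x, r}, c {x, s}]"
proof -
  obtain V' E' f where E': "E' \<subseteq> E" and f: "bij_betw f DS22_verts V'"
    and im: "E' = (\<lambda>e. f ` e) ` DS22_edges" and rb: "inj_on c E'"
    using assms unfolding contains_rainbow_def graph_iso_def rainbow_def by blast
  have inj: "inj_on f {0, 1, 2, 3, 4, 5}"
    using f by (simp add: bij_betw_def DS22_verts_def)
  have d: "distinct [f 0, f 1, f 2, f 3, f 4, f 5]"
    using inj by (auto simp: inj_on_def)
  have E'_eq: "E' = {{f 0, f 1}, {f 0, f 2}, {f 0, f 3}, {f 1, f 4}, {f 1, f 5}}"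
    by (simp add: im DS22_edges_def)
  have "distinct [{f 0, f 1}, {f 0, f 2}, {f 0, f 3}, {f 1, f 4}, {f 1, f 5}]"
    using d by (simp add: doubleton_eq_iff)
  moreover have "inj_on c (set [{f 0, f 1}, {f 0, f 2}, {f 0, f 3}, {f 1, f 4}, {f 1, f 5}])"
    using rb by (simp add: E'_eq)
  ultimately have
    "distinct (map c [{f 0, f 1}, {f 0, f 2}, {f 0, f 3}, {f 1, f 4}, {f 1, f 5}])"
    unfolding distinct_map by blast
  then have "distinct [c {f 0, f 1}, c {f 0, f 2}, c {f 0, f 3}, c {f 1, f 4}, c {f 1, f 5}]"
    unfolding list.map .
  with d E'[unfolded E'_eq] show thesis
    by (rule that)
qed

lemma contains_rainbow_DS22I:
  assumes "simple_graph V E" and d: "distinct [y, x, p, q, r, s]"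
    and sub: "{{y, x}, {y, p}, {y, q}, {x, r}, {x, s}} \<subseteq> E"
    and rb: "distinct [c {y, x}, c {y, p}, c {y, q}, c {x, r}, c {x, s}]"
  shows "contains_rainbow V E c DS22_verts DS22_edges"
proof -
  let ?V' = "{y, x, p, q, r, s}" and ?E' = "{{y, x}, {y, p}, {y, q}, {x, r}, {x, s}}"
  define f where "f = (!) [y, x, p, q, r, s]"
  have f: "f 0 = y" "f 1 = x" "f (Suc 0) = x" "f 2 = p" "f 3 = q" "f 4 = r" "f 5 = s"
    by (simp_all add: f_def)
  have "inj_on f DS22_verts"
    using d by (auto simp: DS22_verts_def inj_on_def f)
  moreover have "f ` DS22_verts = ?V'"
    by (simp add: DS22_verts_def f)
  moreover have "?E' = (\<lambda>e. f ` e) ` DS22_edges"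
    by (simp add: DS22_edges_def f)
  ultimately have "graph_iso DS22_verts DS22_edges ?V' ?E'"
    unfolding graph_iso_def bij_betw_def by blast
  moreover have "?V' \<subseteq> V"
    using sub assms(1) by (auto simp: simple_graph_def nsets_def)
  moreover have "simple_graph ?V' ?E'"
    using d by (auto simp: simple_graph_def nsets_def)
  moreover have "rainbow ?E' c"
  proof -
    have "distinct (map c [{y, x}, {y, p}, {y, q}, {x, r}, {x, s}])"
      using rb by simp
    then have "inj_on c (set [{y, x}, {y, p}, {y, q}, {x, r}, {x, s}])"
      unfolding distinct_map by blast
    then show ?thesis
      by (simp only: rainbow_def list.set)
  qed
  ultimately show ?thesis
    using sub unfolding contains_rainbow_def by (intro exI[of _ ?V'] exI[of _ ?E'] conjI)
qed

section \<open>The upper bound\<close>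

lemma finite_simple_graph:
  assumes "simple_graph V E"
  shows "finite V" "finite E"
  using assms finite_imp_finite_nsets[of V 2]
  by (auto simp: simple_graph_def intro: finite_subset)

text \<open>The vertices adjacent to \<open>v\<close>; in a simple graph their number is the degree of \<open>v\<close>.\<close>

definition neighbors :: "'a set set \<Rightarrow> 'a \<Rightarrow> 'a set" where
  "neighbors E v = {u. {v, u} \<in> E}"

lemma neighbors_subset:
  assumes "simple_graph V E"
  shows "neighbors E v \<subseteq> V - {v}"
  using assms by (auto simp: neighbors_def simple_graph_def nsets_def)

lemma finite_neighbors:
  assumes "simple_graph V E"
  shows "finite (neighbors E v)"
  using neighbors_subset[OF assms, of v] assms
  by (auto simp: simple_graph_def intro: finite_subset)

lemma card_incident_edges:
  assumes "simple_graph V E"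
  shows "card {e \<in> E. v \<in> e} = card (neighbors E v)"
proof -
  have "bij_betw (\<lambda>u. {v, u}) (neighbors E v) {e \<in> E. v \<in> e}"
  proof (rule bij_betw_imageI)
    show "inj_on (\<lambda>u. {v, u}) (neighbors E v)"
      by (auto simp: inj_on_def doubleton_eq_iff)
    show "(\<lambda>u. {v, u}) ` neighbors E v = {e \<in> E. v \<in> e}"
    proof (intro equalityI subsetI)
      fix e assume e: "e \<in> {e \<in> E. v \<in> e}"
      then have "card e = 2"
        using assms by (auto simp: simple_graph_def nsets_def)
      then obtain a b where "e = {a, b}"
        by (auto simp: card_2_iff)
      with e show "e \<in> (\<lambda>u. {v, u}) ` neighbors E v"
        by (auto simp: neighbors_def insert_commute)
    qed (auto simp: neighbors_def)
  qed
  then show ?thesis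
    by (simp add: bij_betw_same_card)
qed

lemma handshake:
  assumes "simple_graph V E"
  shows "(\<Sum>v\<in>V. card (neighbors E v)) = 2 * card E"
proof -
  have fin: "finite V" "finite E"
    using finite_simple_graph[OF assms] by simp_all
  have "(\<Sum>v\<in>V. card (neighbors E v)) = (\<Sum>v\<in>V. card {e \<in> E. v \<in> e})"
    using card_incident_edges[OF assms] by simp
  also have "\<dots> = 2 * card E"
  proof (rule sum_multicount[OF fin], intro ballI)
    fix e assume "e \<in> E"
    then have "{v \<in> V. v \<in> e} = e" "card e = 2"
      using assms by (auto simp: simple_graph_def nsets_def)
    then show "card {v \<in> V. v \<in> e} = 2"
      by simp
  qed
  finally show ?thesis .
qed

lemma obtain_two_elements:
  assumes "2 \<le> card A"
  obtains a b where "a \<in> A" "b \<in> A" "a \<noteq> b"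
proof -
  obtain B where "B \<subseteq> A" "card B = 2"
    using assms obtain_subset_with_card_n by metis
  then show thesis
    using that by (auto simp: card_2_iff)
qed

lemma proper_edge_coloring_at_vertex:
  assumes "proper_edge_coloring E c" "{v, a} \<in> E" "{v, b} \<in> E" "a \<noteq> b"
  shows "c {v, a} \<noteq> c {v, b}"
proof -
  have "{v, a} \<noteq> {v, b}" "{v, a} \<inter> {v, b} \<noteq> {}"
    using assms(4) by (auto simp: doubleton_eq_iff)
  then show ?thesis
    using assms(1-3) unfolding proper_edge_coloring_def by metis
qed

lemma card_color_class_at_vertex_le_1:
  assumes "simple_graph V E" "proper_edge_coloring E c"
  shows "card {w \<in> neighbors E v. c {v, w} = k} \<le> 1"
proof -
  have "a = b" if "a \<in> neighbors E v" "b \<in> neighbors E v" "c {v, a} = c {v, b}" for a b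
    using proper_edge_coloring_at_vertex[OF assms(2)] that by (auto simp: neighbors_def)
  then show ?thesis
    using finite_neighbors[OF assms(1), of v] by (auto simp: card_le_Suc0_iff_eq)
qed

lemma rainbow_double_star_exists:
  assumes G: "simple_graph V E" and c: "proper_edge_coloring E c"
    and v: "7 \<le> card (neighbors E v)" and u: "u \<in> neighbors E v" "3 \<le> card (neighbors E u)"
  shows "contains_rainbow V E c DS22_verts DS22_edges"
proof -
  note fin = finite_neighbors[OF G]
  have "card (neighbors E u) - card {v} \<le> card (neighbors E u - {v})"
    by (intro diff_card_le_card_Diff) simp
  then have "2 \<le> card (neighbors E u - {v})"
    using u(2) by simp
  then obtain p q where p: "p \<in> neighbors E u" "p \<noteq> v" and q: "q \<in> neighbors E u" "q \<noteq> v"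
    and pq: "p \<noteq> q"
    by (elim obtain_two_elements) auto
  let ?K = "\<lambda>k. {w \<in> neighbors E v. c {v, w} = k}"
  \<comment> \<open>The neighbours of \<open>v\<close> that cannot be leaves: \<open>u, p, q\<close> and the at most one on each of
    two colors.\<close>
  let ?F = "{u, p, q} \<union> (?K (c {u, p}) \<union> ?K (c {u, q}))"
  have "card ?F \<le> card {u, p, q} + card (?K (c {u, p}) \<union> ?K (c {u, q}))"
    by (rule card_Un_le)
  also have "card (?K (c {u, p}) \<union> ?K (c {u, q})) \<le> card (?K (c {u, p})) + card (?K (c {u, q}))"
    by (rule card_Un_le)
  also have "card {u, p, q} \<le> 3"
    by (simp add: card_insert_if)
  finally have "card ?F \<le> 5"
    using card_color_class_at_vertex_le_1[OF G c, of v "c {u, p}"]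
      card_color_class_at_vertex_le_1[OF G c, of v "c {u, q}"] by linarith
  moreover have "card (neighbors E v) - card ?F \<le> card (neighbors E v - ?F)"
    using fin by (intro diff_card_le_card_Diff) simp
  ultimately have "2 \<le> card (neighbors E v - ?F)"
    using v by linarith
  then obtain r s where r: "r \<in> neighbors E v - ?F" and s: "s \<in> neighbors E v - ?F"
    and rs: "r \<noteq> s"
    by (elim obtain_two_elements)
  have edges: "{u, v} \<in> E" "{u, p} \<in> E" "{u, q} \<in> E" "{v, r} \<in> E" "{v, s} \<in> E"
    using u p q r s by (auto simp: neighbors_def insert_commute)
  have neq: "u \<noteq> v" "u \<noteq> p" "u \<noteq> q" "v \<noteq> r" "v \<noteq> s"
    using neighbors_subset[OF G] u p q r s by auto
  have d: "distinct [u, v, p, q, r, s]"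
    using neq p q r s rs pq by auto
  have "c {u, v} \<noteq> c {u, p}" "c {u, v} \<noteq> c {u, q}" "c {u, p} \<noteq> c {u, q}"
    "c {u, v} \<noteq> c {v, r}" "c {u, v} \<noteq> c {v, s}" "c {v, r} \<noteq> c {v, s}"
    using proper_edge_coloring_at_vertex[OF c, of u]
      proper_edge_coloring_at_vertex[OF c, of v u] proper_edge_coloring_at_vertex[OF c, of v r s] edges d
    by (simp_all add: insert_commute[of v u])
  moreover have "c {v, r} \<noteq> c {u, p}" "c {v, r} \<noteq> c {u, q}" "c {v, s} \<noteq> c {u, p}" "c {v, s} \<noteq> c {u, q}"
    using r s by auto
  ultimately have "distinct [c {u, v}, c {u, p}, c {u, q}, c {v, r}, c {v, s}]"
    by auto
  then show ?thesis
    using d edges by (intro contains_rainbow_DS22I[OF G]) auto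
qed

lemma contains_rainbow_mono:
  assumes "contains_rainbow W F c VF EF" "W \<subseteq> V" "F \<subseteq> E"
  shows "contains_rainbow V E c VF EF"
  using assms unfolding contains_rainbow_def by (meson order_trans)

theorem card_edges_le_3_card_verts:
  assumes "simple_graph V E" "proper_edge_coloring E c"
    and "\<not> contains_rainbow V E c DS22_verts DS22_edges"
  shows "card E \<le> 3 * card V"
  using assms
proof (induction "card V" arbitrary: V E rule: less_induct)
  case less
  note G = less.prems(1)
  have fin: "finite V" "finite E"
    using finite_simple_graph[OF G] by simp_all
  show ?case
  proof (cases "\<exists>v\<in>V. card (neighbors E v) \<le> 3")
    case True
    then obtain v where v: "v \<in> V" "card (neighbors E v) \<le> 3"
      by blast
    let ?F = "{e \<in> E. v \<notin> e}"
    have cV: "card V = Suc (card (V - {v}))"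
      using card_Suc_Diff1[OF fin(1) v(1)] by simp
    have "card ?F \<le> 3 * card (V - {v})"
    proof (rule less.hyps)
      show "card (V - {v}) < card V"
        using cV by simp
      show "simple_graph (V - {v}) ?F"
        using G by (auto simp: simple_graph_def nsets_def)
      show "proper_edge_coloring ?F c"
        using less.prems(2) by (auto simp: proper_edge_coloring_def)
      show "\<not> contains_rainbow (V - {v}) ?F c DS22_verts DS22_edges"
        using less.prems(3) contains_rainbow_mono[of "V - {v}" ?F c _ _ V E] by blast
    qed
    moreover have "card E = card ?F + card {e \<in> E. v \<in> e}"
    proof -
      have "E = ?F \<union> {e \<in> E. v \<in> e}"
        by blast
      then have "card E = card (?F \<union> {e \<in> E. v \<in> e})"
        by simp
      also have "\<dots> = card ?F + card {e \<in> E. v \<in> e}"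
        using fin by (intro card_Un_disjoint) auto
      finally show ?thesis .
    qed
    ultimately show ?thesis
      using v(2) cV card_incident_edges[OF G, of v] by linarith
  next
    case False
    have "card (neighbors E v) \<le> 6" if "v \<in> V" for v
    proof (rule ccontr)
      assume deg: "\<not> card (neighbors E v) \<le> 6"
      then obtain u where u: "u \<in> neighbors E v"
        by (metis card.empty ex_in_conv zero_le)
      then have "u \<in> V"
        using neighbors_subset[OF G] by blast
      then have "3 \<le> card (neighbors E u)"
        using False by fastforce
      then show False
        using rainbow_double_star_exists[OF G less.prems(2) _ u] deg less.prems(3) by simp
    qed
    then have "(\<Sum>v\<in>V. card (neighbors E v)) \<le> card V * 6"
      using sum_bounded_above[of V "\<lambda>v. card (neighbors E v)" 6] by simp
    then show ?thesis
      using handshake[OF G] by simp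
  qed
qed

lemma rainbow_turan_DS22_le: "rainbow_turan n DS22_verts DS22_edges \<le> 3 * n"
proof -
  have "DS22_edges \<noteq> {}"
    by (simp add: DS22_edges_def)
  then have "rainbow_turan_candidates n DS22_verts DS22_edges \<noteq> {}"
    by (rule rainbow_turan_candidates_nonempty)
  moreover have "card E \<le> 3 * n" if "E \<in> rainbow_turan_candidates n DS22_verts DS22_edges" for E
    using that card_edges_le_3_card_verts[of "{..<n}" E]
    by (auto simp: rainbow_turan_candidates_def)
  ultimately show ?thesis
    unfolding rainbow_turan_def
    by (subst Max_le_iff) (auto simp: finite_rainbow_turan_candidates)
qed

section \<open>The lower bound\<close>

text \<open>The edges of disjoint copies of \<open>K\<^sub>6\<close> on consecutive blocks of six numbers.\<close>

definition K6_blocks :: "nat \<Rightarrow> nat set set" where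
  "K6_blocks m = (\<Union>j<m. nsets {6 * j..<6 * j + 6} 2)"

text \<open>The one-factorization of \<open>K\<^sub>6\<close> on the integers modulo 5 and a point at infinity, here
  represented by 5: the color of \<open>{a, b}\<close> is \<open>a + b\<close>, and the color of an edge from infinity to
  \<open>a\<close> is \<open>a + a\<close>.\<close>

definition K6_color :: "nat \<Rightarrow> nat \<Rightarrow> nat" where
  "K6_color a b = (if a = 5 then 2 * b else if b = 5 then 2 * a else a + b) mod 5"

text \<open>The coloring of all blocks; the minimum and maximum serve only to name the two ends of an
  edge.\<close>

definition block_color :: "nat set \<Rightarrow> nat" where
  "block_color e = K6_color (Min e mod 6) (Max e mod 6)"

lemma K6_color_commute: "K6_color a b = K6_color b a"
  by (auto simp: K6_color_def add.commute)

lemma block_color_doubleton: "block_color {x, y} = K6_color (x mod 6) (y mod 6)"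
  by (cases x y rule: linorder_cases) (auto simp: block_color_def K6_color_commute)

lemma K6_color_less: "K6_color a b < 5"
  by (simp add: K6_color_def)

lemma K6_color_proper:
  assumes "a < 6" "b < 6" "d < 6" "distinct [a, b, d]"
  shows "K6_color a b \<noteq> K6_color a d"
proof -
  have "\<forall>a\<in>set [0..<6]. \<forall>b\<in>set [0..<6]. \<forall>d\<in>set [0..<6].
      distinct [a, b, d] \<longrightarrow> K6_color a b \<noteq> K6_color a d"
    by code_simp
  with assms show ?thesis by simp
qed

lemma K6_color_no_bicolored_4_cycle:
  assumes "y < 6" "x < 6" "p < 6" "q < 6" "distinct [y, x, p, q]"
  shows "\<not> (K6_color y p = K6_color x q \<and> K6_color y q = K6_color x p)"
proof -
  have "\<forall>y\<in>set [0..<6]. \<forall>x\<in>set [0..<6]. \<forall>p\<in>set [0..<6]. \<forall>q\<in>set [0..<6].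
      distinct [y, x, p, q] \<longrightarrow> \<not> (K6_color y p = K6_color x q \<and> K6_color y q = K6_color x p)"
    by code_simp
  with assms show ?thesis by simp
qed

lemma K6_no_rainbow_double_star:
  assumes lt: "y < 6" "x < 6" "p < 6" "q < 6" "r < 6" "s < 6"
    and d: "distinct [y, x, p, q, r, s]"
  shows "\<not> distinct [K6_color y x, K6_color y p, K6_color y q, K6_color x r, K6_color x s]"
proof
  let ?k = K6_color
  assume rb: "distinct [?k y x, ?k y p, ?k y q, ?k x r, ?k x s]"
  have proper: "?k a b \<noteq> ?k a e" if "a < 6" "b < 6" "e < 6" "a \<noteq> b" "a \<noteq> e" "b \<noteq> e" for a b e
    using K6_color_proper that by simp
  have "distinct [?k x y, ?k x p, ?k x q, ?k x r, ?k x s]"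
    using lt d proper[of x y] proper[of x p] proper[of x q] proper[of x r] by auto
  then have "card (set [?k x y, ?k x p, ?k x q, ?k x r, ?k x s]) = 5"
    by (subst distinct_card) simp_all
  moreover have "set [?k x y, ?k x p, ?k x q, ?k x r, ?k x s] \<subseteq> {..<5}"
    by (simp add: K6_color_less)
  ultimately have all: "{..<5} = set [?k x y, ?k x p, ?k x q, ?k x r, ?k x s]"
    by (metis card_lessThan card_subset_eq finite_lessThan)
  have "?k y z \<in> {?k x p, ?k x q}" if "z \<in> {p, q}" for z
  proof -
    have "?k y z \<in> set [?k x y, ?k x p, ?k x q, ?k x r, ?k x s]"
      unfolding all[symmetric] by (simp add: K6_color_less)
    moreover have "?k y z \<notin> {?k x y, ?k x r, ?k x s}"
      using rb that by (auto simp: K6_color_commute[of x y])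
    ultimately show ?thesis
      by auto
  qed
  moreover have "?k y z \<noteq> ?k x z" if "z \<in> {p, q}" for z
    using proper[of z y x] that lt d by (auto simp: K6_color_commute[of _ z])
  ultimately have "?k y p = ?k x q" "?k y q = ?k x p"
    by blast+
  then show False
    using K6_color_no_bicolored_4_cycle lt d by simp
qed

lemma doubleton_in_K6_blocks:
  assumes "{x, y} \<in> K6_blocks m"
  shows "x \<noteq> y" "x div 6 = y div 6"
proof -
  obtain j where j: "{x, y} \<in> nsets {6 * j..<6 * j + 6} 2"
    using assms by (auto simp: K6_blocks_def)
  then show "x \<noteq> y"
    by (auto simp: nsets_def)
  have "z div 6 = j" if "6 * j \<le> z" "z < 6 * j + 6" for z
    using that by (intro div_nat_eqI) auto
  then show "x div 6 = y div 6"
    using j by (auto simp: nsets_def)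
qed

lemma same_block_mod_neq:
  fixes x y :: nat
  assumes "x div 6 = y div 6" "x \<noteq> y"
  shows "x mod 6 \<noteq> y mod 6"
  using assms by (metis div_mult_mod_eq)

lemma simple_graph_K6_blocks:
  assumes "6 * m \<le> n"
  shows "simple_graph {..<n} (K6_blocks m)"
proof -
  have "6 * j + 6 \<le> n" if "j < m" for j
    using that assms by linarith
  then show ?thesis
    unfolding simple_graph_def K6_blocks_def nsets_def by fastforce
qed

lemma proper_block_color: "proper_edge_coloring (K6_blocks m) block_color"
  unfolding proper_edge_coloring_def
proof (intro ballI impI)
  fix e f assume ef: "e \<in> K6_blocks m" "f \<in> K6_blocks m" and ne: "e \<noteq> f \<and> e \<inter> f \<noteq> {}"
  then obtain x where x: "x \<in> e" "x \<in> f"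
    by blast
  have pair: "\<exists>y. g = {x, y}" if "g \<in> K6_blocks m" "x \<in> g" for g
    using that by (force simp: K6_blocks_def nsets_def card_2_iff)
  obtain y z where y: "e = {x, y}" and z: "f = {x, z}"
    using pair ef x by meson
  have "y \<noteq> z" "x \<noteq> y" "x \<noteq> z" "y div 6 = x div 6" "z div 6 = x div 6"
    using ne y z doubleton_in_K6_blocks[OF ef(1)[unfolded y]]
      doubleton_in_K6_blocks[OF ef(2)[unfolded z]] by auto
  then have "distinct [x mod 6, y mod 6, z mod 6]"
    by (simp add: same_block_mod_neq)
  then show "block_color e \<noteq> block_color f"
    unfolding y z block_color_doubleton by (intro K6_color_proper) simp_all
qed

lemma K6_blocks_no_rainbow_DS22:
  assumes "6 * m \<le> n"
  shows "\<not> contains_rainbow {..<n} (K6_blocks m) block_color DS22_verts DS22_edges"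
proof
  assume "contains_rainbow {..<n} (K6_blocks m) block_color DS22_verts DS22_edges"
  then obtain y x p q r s where d: "distinct [y, x, p, q, r, s]"
    and sub: "{{y, x}, {y, p}, {y, q}, {x, r}, {x, s}} \<subseteq> K6_blocks m"
    and rb: "distinct [block_color {y, x}, block_color {y, p}, block_color {y, q},
      block_color {x, r}, block_color {x, s}]"
    by (rule contains_rainbow_DS22E)
  \<comment> \<open>The double star is connected, so it lies in one block.\<close>
  have "y div 6 = x div 6" "p div 6 = x div 6" "q div 6 = x div 6" "r div 6 = x div 6"
    "s div 6 = x div 6"
    using sub doubleton_in_K6_blocks(2)[of _ _ m] by (metis insert_subset)+
  then have "distinct [y mod 6, x mod 6, p mod 6, q mod 6, r mod 6, s mod 6]"
    using d by (simp add: same_block_mod_neq)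
  then show False
    using K6_no_rainbow_double_star[of "y mod 6" "x mod 6" "p mod 6" "q mod 6" "r mod 6" "s mod 6"]
      rb by (simp add: block_color_doubleton)
qed

lemma card_K6_blocks: "card (K6_blocks m) = 15 * m"
proof -
  have "card (K6_blocks m) = (\<Sum>j<m. card (nsets {6 * j..<6 * j + 6} 2))"
    unfolding K6_blocks_def
  proof (rule card_UN_disjoint)
    show "\<forall>j\<in>{..<m}. finite (nsets {6 * j..<6 * j + 6} 2)"
      by (simp add: finite_imp_finite_nsets)
    show "\<forall>i\<in>{..<m}. \<forall>j\<in>{..<m}. i \<noteq> j \<longrightarrow>
        nsets {6 * i..<6 * i + 6} 2 \<inter> nsets {6 * j..<6 * j + 6} 2 = {}"
    proof (intro ballI impI)
      fix i j :: nat assume "i \<noteq> j"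
      then have "{6 * i..<6 * i + 6} \<inter> {6 * j..<6 * j + 6} = {}"
        by auto
      then show "nsets {6 * i..<6 * i + 6} 2 \<inter> nsets {6 * j..<6 * j + 6} 2 = {}"
        by (auto simp: nsets_def dest!: Int_greatest[of _ "{6 * i..<6 * i + 6}"])
    qed
  qed simp
  also have "\<dots> = (\<Sum>j<m. 6 choose 2)"
    by simp
  also have "\<dots> = 15 * m"
    by (simp add: choose_two)
  finally show ?thesis .
qed

lemma rainbow_turan_DS22_ge: "15 * (n div 6) \<le> rainbow_turan n DS22_verts DS22_edges"
proof -
  have le: "6 * (n div 6) \<le> n"
    by simp
  have "K6_blocks (n div 6) \<in> rainbow_turan_candidates n DS22_verts DS22_edges"
    unfolding rainbow_turan_candidates_def
    using simple_graph_K6_blocks[OF le] proper_block_color K6_blocks_no_rainbow_DS22[OF le]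
    by blast
  then have "card (K6_blocks (n div 6)) \<le> rainbow_turan n DS22_verts DS22_edges"
    unfolding rainbow_turan_def
    by (intro Max_ge finite_imageI finite_rainbow_turan_candidates imageI)
  then show ?thesis
    by (simp add: card_K6_blocks)
qed

section \<open>The rainbow Turan number of the double star\<close>

theorem theorem4p10:
  "(\<forall>n::nat. 6 dvd n \<longrightarrow>
       5 * real n / 2 \<le> real (rainbow_turan n DS22_verts DS22_edges) \<and>
       real (rainbow_turan n DS22_verts DS22_edges) \<le> 6 * real n / 2) \<and>
   (\<exists>C::real. \<forall>n::nat.
       5 * real n / 2 - C \<le> real (rainbow_turan n DS22_verts DS22_edges) \<and>
       real (rainbow_turan n DS22_verts DS22_edges) \<le> 6 * real n / 2)"
proof -
  let ?ex = "\<lambda>n. rainbow_turan n DS22_verts DS22_edges"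
  have upper: "real (?ex n) \<le> 6 * real n / 2" for n
    using rainbow_turan_DS22_le[of n] by linarith
  have lower: "15 * real (n div 6) \<le> real (?ex n)" for n
    using rainbow_turan_DS22_ge[of n] by linarith
  have "5 * real n / 2 \<le> real (?ex n)" if "6 dvd n" for n
    using lower[of n] that by auto
  \<comment> \<open>At most five vertices lie outside the copies of \<open>K\<^sub>6\<close>, which costs \<open>5 \<cdot> 5 / 2\<close> in the bound.\<close>
  moreover have "5 * real n / 2 - 25 / 2 \<le> real (?ex n)" for n
  proof -
    have "n \<le> 6 * (n div 6) + 5"
      by linarith
    then show ?thesis
      using lower[of n] by linarith
  qed
  ultimately show ?thesis
    using upper by blast
qed

end
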